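(* Let $d$ be an integer, and assume a triangulated category $\mathcal T$ and $M\in\mathsf{silt}\,\mathcal T$ satisfy the conditions (T0), (T1), (T2), (T3) listed in the context. Moreover, assume that $\mathcal T$ is $\nu_d$-finite. Then there exist no $n\ge1$ and simple objects $S_1,\dots,S_n,S_{n+1}=S_1\in\mathcal H_M$ such that $\mathcal T(S_i,S_{i+1}[d])\neq0$ holds for all $1\le i\le n$. In particular, there exists no simple object $S\in\mathcal H_M$ such that $\mathcal T(S,S[d])\ne0$ holds.
   Context: $k$ is a field, categories are $k$-linear, $D=\mathrm{Hom}_k(-,k)$, and $\mathcal T(X,Y)$ denotes Hom spaces in $\mathcal T$. $M\in\mathcal T$ is silting if $\mathcal T(M,M[i])=0$ for all $i>0$ and $\mathcal T=\mathsf{thick}\,M$; $\mathsf{silt}\,\mathcal T$ is the class of silting objects. For $M,N\in\mathsf{silt}\,\mathcal T$, $M\ge N$ means $\mathcal T(M,N[i])=0$ for all $i>0$. Conditions: (T0) $\mathcal T$ is Hom-finite and Krull–Schmidt. (T1) $\mathcal T$ has a Serre functor $\nu$ (an autoequivalence with natural isomorphisms $\mathcal T(X,Y)\cong D\mathcal T(Y,\nu X)$); put $\nu_d:=\nu\circ[-d]$. (T2) $M$ admits a right adjacent t-structure: the pair $\mathcal T_M^{\le0}:=\{X\mid\mathcal T(M,X[i])=0\ \forall i>0\}$, $\mathcal T_M^{\ge0}:=\{X\mid\mathcal T(M,X[i])=0\ \forall i<0\}$ is a t-structure on $\mathcal T$; its heart is $\mathcal H_M:=\mathcal T_M^{\le0}\cap\mathcal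 T_M^{\ge0}$. (T3) $M$ is $d$-silting, i.e. $M\ge\nu_d^{-1}M$. $\mathcal T$ is $\nu_d$-finite if for all $X,Y\in\mathcal T$ one has, for all $i\gg0$, $\mathcal T(X,\nu_d^{-i}(Y)[j])=0$ for all $j\ge0$. *)

theory Defs
  imports Complex_Main
begin

text \<open>
  Small \<open>k\<close>-linear categories over the field \<open>'k\<close>. Every element of the type \<open>'o\<close> is an object. All
  Hom spaces are subspaces of one ambient vector space \<open>'m\<close>, so that they share the zero vector,
  addition and scalar multiplication; different Hom spaces may overlap, and therefore objects are
  always mentioned explicitly. Every small \<open>k\<close>-linear category has this form: take for \<open>'m\<close> the
  direct sum of all its Hom spaces. Composition is only constrained on composable arguments.
\<close>

record ('k, 'o, 'm) lin_cat =
  Hom :: "'o \<Rightarrow> 'o \<Rightarrow> 'm set"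
  Comp :: "'m \<Rightarrow> 'm \<Rightarrow> 'm"  (infixl "\<cdot>\<index>" 70)
  Ident :: "'o \<Rightarrow> 'm"
  Scale :: "'k \<Rightarrow> 'm \<Rightarrow> 'm"

locale linear_category =
  fixes C :: "('k::field, 'o, 'm::ab_group_add, 'z) lin_cat_scheme" (structure)
  assumes vector_space_Scale: "vector_space (Scale C)"
    and subspace_Hom: "module.subspace (Scale C) (Hom C X Y)"
    and Id_in: "Ident C X \<in> Hom C X X"
    and Comp_in: "\<lbrakk>f \<in> Hom C X Y; g \<in> Hom C Y Z\<rbrakk> \<Longrightarrow> g \<cdot> f \<in> Hom C X Z"
    and Comp_assoc: "\<lbrakk>f \<in> Hom C W X; g \<in> Hom C X Y; h \<in> Hom C Y Z\<rbrakk> \<Longrightarrow> (h \<cdot> g) \<cdot> f = h \<cdot> (g \<cdot> f)"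
    and Comp_Id_right: "f \<in> Hom C X Y \<Longrightarrow> f \<cdot> Ident C X = f"
    and Comp_Id_left: "f \<in> Hom C X Y \<Longrightarrow> Ident C Y \<cdot> f = f"
    and Comp_add_right: "\<lbrakk>f \<in> Hom C X Y; f' \<in> Hom C X Y; g \<in> Hom C Y Z\<rbrakk> \<Longrightarrow> g \<cdot> (f + f') = g \<cdot> f + g \<cdot> f'"
    and Comp_add_left: "\<lbrakk>f \<in> Hom C X Y; g \<in> Hom C Y Z; g' \<in> Hom C Y Z\<rbrakk> \<Longrightarrow> (g + g') \<cdot> f = g \<cdot> f + g' \<cdot> f"
    and Comp_Scale_right: "\<lbrakk>f \<in> Hom C X Y; g \<in> Hom C Y Z\<rbrakk> \<Longrightarrow> g \<cdot> Scale C c f = Scale C c (g \<cdot> f)"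
    and Comp_Scale_left: "\<lbrakk>f \<in> Hom C X Y; g \<in> Hom C Y Z\<rbrakk> \<Longrightarrow> Scale C c g \<cdot> f = Scale C c (g \<cdot> f)"

definition is_iso :: "('k, 'o, 'm, 'z) lin_cat_scheme \<Rightarrow> 'o \<Rightarrow> 'o \<Rightarrow> 'm \<Rightarrow> bool" where
  "is_iso C X Y f \<longleftrightarrow> f \<in> Hom C X Y \<and>
     (\<exists>g \<in> Hom C Y X. g \<cdot>\<^bsub>C\<^esub> f = Ident C X \<and> f \<cdot>\<^bsub>C\<^esub> g = Ident C Y)"

definition iso_closed :: "('k, 'o, 'm, 'z) lin_cat_scheme \<Rightarrow> 'o set \<Rightarrow> bool" where
  "iso_closed C U \<longleftrightarrow> (\<forall>X Y f. X \<in> U \<and> is_iso C X Y f \<longrightarrow> Y \<in> U)"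

definition zero_object :: "('k, 'o, 'm::zero, 'z) lin_cat_scheme \<Rightarrow> 'o \<Rightarrow> bool" where
  "zero_object C Z \<longleftrightarrow> (\<forall>X. Hom C X Z = {0} \<and> Hom C Z X = {0})"

text \<open>\<open>X\<close> is the biproduct of \<open>Y 0, \<dots>, Y (n - 1)\<close>; for \<open>n = 0\<close> this says that \<open>X\<close> is a zero object.\<close>

definition biproduct ::
  "('k, 'o, 'm::ab_group_add, 'z) lin_cat_scheme \<Rightarrow> nat \<Rightarrow> (nat \<Rightarrow> 'o) \<Rightarrow> 'o \<Rightarrow>
   (nat \<Rightarrow> 'm) \<Rightarrow> (nat \<Rightarrow> 'm) \<Rightarrow> bool" where
  "biproduct C n Y X i p \<longleftrightarrow>
     (\<forall>a<n. i a \<in> Hom C (Y a) X \<and> p a \<in> Hom C X (Y a)) \<and>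
     (\<forall>a<n. \<forall>b<n. p a \<cdot>\<^bsub>C\<^esub> i b = (if a = b then Ident C (Y a) else 0)) \<and>
     (\<Sum>a<n. i a \<cdot>\<^bsub>C\<^esub> p a) = Ident C X"

definition direct_summand :: "('k, 'o, 'm::ab_group_add, 'z) lin_cat_scheme \<Rightarrow> 'o \<Rightarrow> 'o \<Rightarrow> bool" where
  "direct_summand C Y X \<longleftrightarrow> (\<exists>Z i p. biproduct C 2 Z X i p \<and> Z 0 = Y)"

locale additive_category = linear_category +
  assumes ex_biproduct: "\<exists>X i p. biproduct C n Y X i p"

definition hom_finite :: "('k::field, 'o, 'm::ab_group_add, 'z) lin_cat_scheme \<Rightarrow> bool" where
  "hom_finite C \<longleftrightarrow> (\<forall>X Y. \<exists>B. finite B \<and> module.span (Scale C) B = Hom C X Y)"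

text \<open>A ring is local if it is nonzero and the sum of two non-units is a non-unit.\<close>

definition local_endomorphism_ring :: "('k, 'o, 'm::ab_group_add, 'z) lin_cat_scheme \<Rightarrow> 'o \<Rightarrow> bool" where
  "local_endomorphism_ring C X \<longleftrightarrow> Ident C X \<noteq> 0 \<and>
     (\<forall>f \<in> Hom C X X. \<forall>g \<in> Hom C X X.
        \<not> is_iso C X X f \<and> \<not> is_iso C X X g \<longrightarrow> \<not> is_iso C X X (f + g))"

definition krull_schmidt :: "('k, 'o, 'm::ab_group_add, 'z) lin_cat_scheme \<Rightarrow> bool" where
  "krull_schmidt C \<longleftrightarrow>
     (\<forall>X. \<exists>n Y i p. biproduct C n Y X i p \<and> (\<forall>a<n. local_endomorphism_ring C (Y a)))"

record ('o, 'm) endofunctor =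
  on_obj :: "'o \<Rightarrow> 'o"
  on_mor :: "'m \<Rightarrow> 'm"

definition linear_functor ::
  "('k, 'o, 'm::ab_group_add, 'z) lin_cat_scheme \<Rightarrow> ('o, 'm) endofunctor \<Rightarrow> bool" where
  "linear_functor C F \<longleftrightarrow>
     (\<forall>X Y. \<forall>f \<in> Hom C X Y. on_mor F f \<in> Hom C (on_obj F X) (on_obj F Y)) \<and>
     (\<forall>X. on_mor F (Ident C X) = Ident C (on_obj F X)) \<and>
     (\<forall>X Y Z. \<forall>f \<in> Hom C X Y. \<forall>g \<in> Hom C Y Z. on_mor F (g \<cdot>\<^bsub>C\<^esub> f) = on_mor F g \<cdot>\<^bsub>C\<^esub> on_mor F f) \<and>
     (\<forall>X Y. \<forall>f \<in> Hom C X Y. \<forall>g \<in> Hom C X Y. on_mor F (f + g) = on_mor F f + on_mor F g) \<and>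
     (\<forall>X Y c. \<forall>f \<in> Hom C X Y. on_mor F (Scale C c f) = Scale C c (on_mor F f))"

definition id_functor :: "('o, 'm) endofunctor" where
  "id_functor = \<lparr>on_obj = (\<lambda>X. X), on_mor = (\<lambda>f. f)\<rparr>"

definition comp_functor :: "('o, 'm) endofunctor \<Rightarrow> ('o, 'm) endofunctor \<Rightarrow> ('o, 'm) endofunctor" where
  "comp_functor G F = \<lparr>on_obj = on_obj G \<circ> on_obj F, on_mor = on_mor G \<circ> on_mor F\<rparr>"

definition naturally_isomorphic ::
  "('k, 'o, 'm, 'z) lin_cat_scheme \<Rightarrow> ('o, 'm) endofunctor \<Rightarrow> ('o, 'm) endofunctor \<Rightarrow> bool" where
  "naturally_isomorphic C F G \<longleftrightarrow>
     (\<exists>t. (\<forall>X. is_iso C (on_obj F X) (on_obj G X) (t X)) \<and>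
          (\<forall>X Y. \<forall>f \<in> Hom C X Y. t Y \<cdot>\<^bsub>C\<^esub> on_mor F f = on_mor G f \<cdot>\<^bsub>C\<^esub> t X))"

definition quasi_inverse ::
  "('k, 'o, 'm::ab_group_add, 'z) lin_cat_scheme \<Rightarrow> ('o, 'm) endofunctor \<Rightarrow> ('o, 'm) endofunctor \<Rightarrow> bool" where
  "quasi_inverse C F G \<longleftrightarrow> linear_functor C F \<and> linear_functor C G \<and>
     naturally_isomorphic C (comp_functor G F) id_functor \<and>
     naturally_isomorphic C (comp_functor F G) id_functor"

definition autoequivalence ::
  "('k, 'o, 'm::ab_group_add, 'z) lin_cat_scheme \<Rightarrow> ('o, 'm) endofunctor \<Rightarrow> bool" where
  "autoequivalence C F \<longleftrightarrow> (\<exists>G. quasi_inverse C F G)"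

text \<open>
  The dual of a subspace \<open>V\<close> of \<open>'m\<close>; a functional on \<open>V\<close> is represented by its extension by \<open>0\<close>
  outside \<open>V\<close>, so that it is determined by its values on \<open>V\<close>.
\<close>

definition dual :: "('k::field, 'o, 'm::ab_group_add, 'z) lin_cat_scheme \<Rightarrow> 'm set \<Rightarrow> ('m \<Rightarrow> 'k) set" where
  "dual C V = {\<phi>. (\<forall>x \<in> V. \<forall>y \<in> V. \<phi> (x + y) = \<phi> x + \<phi> y) \<and>
                  (\<forall>c. \<forall>x \<in> V. \<phi> (Scale C c x) = c * \<phi> x) \<and>
                  (\<forall>x. x \<notin> V \<longrightarrow> \<phi> x = 0)}"

text \<open>
  The map \<open>\<phi> X Y\<close> below is the linear isomorphism from \<open>Hom(X, Y)\<close> to \<open>D Hom(Y, \<nu> X)\<close>; the last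
  clause is its naturality, simultaneously in \<open>X\<close> (along \<open>a\<close>) and in \<open>Y\<close> (along \<open>b\<close>).
\<close>

definition serre_functor ::
  "('k::field, 'o, 'm::ab_group_add, 'z) lin_cat_scheme \<Rightarrow> ('o, 'm) endofunctor \<Rightarrow> bool" where
  "serre_functor C \<nu> \<longleftrightarrow> autoequivalence C \<nu> \<and>
     (\<exists>\<phi>. (\<forall>X Y. bij_betw (\<phi> X Y) (Hom C X Y) (dual C (Hom C Y (on_obj \<nu> X)))) \<and>
          (\<forall>X Y. \<forall>f \<in> Hom C X Y. \<forall>g \<in> Hom C X Y. \<forall>h. \<phi> X Y (f + g) h = \<phi> X Y f h + \<phi> X Y g h) \<and>
          (\<forall>X Y c. \<forall>f \<in> Hom C X Y. \<forall>h. \<phi> X Y (Scale C c f) h = c * \<phi> X Y f h) \<and>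
          (\<forall>X X' Y Y'. \<forall>f \<in> Hom C X Y. \<forall>a \<in> Hom C X' X. \<forall>b \<in> Hom C Y Y'.
             \<forall>h \<in> Hom C Y' (on_obj \<nu> X').
               \<phi> X' Y' (b \<cdot>\<^bsub>C\<^esub> f \<cdot>\<^bsub>C\<^esub> a) h = \<phi> X Y f (on_mor \<nu> a \<cdot>\<^bsub>C\<^esub> h \<cdot>\<^bsub>C\<^esub> b)))"

text \<open>
  Triangulated categories in the sense of Verdier; the suspension is an automorphism of the category.
  \<open>distinguished T X Y Z u v w\<close> says that \<open>X \<rightarrow> Y \<rightarrow> Z \<rightarrow> X[1]\<close> with maps \<open>u\<close>, \<open>v\<close>, \<open>w\<close> is a distinguished triangle.
\<close>

record ('k, 'o, 'm) tri_cat = "('k, 'o, 'm) lin_cat" +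
  susp :: "('o, 'm) endofunctor"
  distinguished :: "'o \<Rightarrow> 'o \<Rightarrow> 'o \<Rightarrow> 'm \<Rightarrow> 'm \<Rightarrow> 'm \<Rightarrow> bool"

abbreviation suspO :: "('k, 'o, 'm, 'z) tri_cat_scheme \<Rightarrow> 'o \<Rightarrow> 'o" where
  "suspO T \<equiv> on_obj (susp T)"

abbreviation suspM :: "('k, 'o, 'm, 'z) tri_cat_scheme \<Rightarrow> 'm \<Rightarrow> 'm" where
  "suspM T \<equiv> on_mor (susp T)"

locale triangulated_category =
  additive_category T for T :: "('k::field, 'o, 'm::ab_group_add, 'z) tri_cat_scheme" (structure) +
  assumes susp_functor: "linear_functor T (susp T)"
    and bij_suspO: "bij (suspO T)"
    and bij_suspM: "bij_betw (suspM T) (Hom T X Y) (Hom T (suspO T X) (suspO T Y))"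
    and dist_Hom: "distinguished T X Y Z u v w \<Longrightarrow>
           u \<in> Hom T X Y \<and> v \<in> Hom T Y Z \<and> w \<in> Hom T Z (suspO T X)"
    and TR1_iso: "\<lbrakk>distinguished T X Y Z u v w; is_iso T X X' a; is_iso T Y Y' b; is_iso T Z Z' c;
           u' \<in> Hom T X' Y'; v' \<in> Hom T Y' Z'; w' \<in> Hom T Z' (suspO T X');
           u' \<cdot> a = b \<cdot> u; v' \<cdot> b = c \<cdot> v; w' \<cdot> c = suspM T a \<cdot> w\<rbrakk>
         \<Longrightarrow> distinguished T X' Y' Z' u' v' w'"
    and TR1_Id: "zero_object T Z \<Longrightarrow> distinguished T X X Z (Ident T X) 0 0"
    and TR1_cone: "u \<in> Hom T X Y \<Longrightarrow> \<exists>Z v w. distinguished T X Y Z u v w"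
    and TR2: "\<lbrakk>u \<in> Hom T X Y; v \<in> Hom T Y Z; w \<in> Hom T Z (suspO T X)\<rbrakk>
         \<Longrightarrow> distinguished T X Y Z u v w \<longleftrightarrow> distinguished T Y Z (suspO T X) v w (- suspM T u)"
    and TR3: "\<lbrakk>distinguished T X Y Z u v w; distinguished T X' Y' Z' u' v' w';
           a \<in> Hom T X X'; b \<in> Hom T Y Y'; u' \<cdot> a = b \<cdot> u\<rbrakk>
         \<Longrightarrow> \<exists>c \<in> Hom T Z Z'. v' \<cdot> b = c \<cdot> v \<and> w' \<cdot> c = suspM T a \<cdot> w"
    and TR4: "\<lbrakk>distinguished T X Y Z' u i i'; distinguished T Y Z X' v j j'; distinguished T X Z Y' (v \<cdot> u) k k'\<rbrakk>
         \<Longrightarrow> \<exists>f \<in> Hom T Z' Y'. \<exists>g \<in> Hom T Y' X'.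
               distinguished T Z' Y' X' f g (suspM T i \<cdot> j') \<and>
               f \<cdot> i = k \<cdot> v \<and> k' \<cdot> f = i' \<and> g \<cdot> k = j \<and> j' \<cdot> g = suspM T u \<cdot> k'"

definition shift :: "('k, 'o, 'm, 'z) tri_cat_scheme \<Rightarrow> int \<Rightarrow> 'o \<Rightarrow> 'o" where
  "shift T n = (if 0 \<le> n then suspO T ^^ nat n else inv (suspO T) ^^ nat (- n))"

definition thick_subcategory :: "('k, 'o, 'm::ab_group_add, 'z) tri_cat_scheme \<Rightarrow> 'o set \<Rightarrow> bool" where
  "thick_subcategory T U \<longleftrightarrow>
     iso_closed T U \<and>
     (\<forall>Z. zero_object T Z \<longrightarrow> Z \<in> U) \<and>
     (\<forall>X \<in> U. shift T 1 X \<in> U \<and> shift T (-1) X \<in> U) \<and>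
     (\<forall>X Y Z u v w. distinguished T X Y Z u v w \<and> X \<in> U \<and> Y \<in> U \<longrightarrow> Z \<in> U) \<and>
     (\<forall>X Y. X \<in> U \<and> direct_summand T Y X \<longrightarrow> Y \<in> U)"

definition thick :: "('k, 'o, 'm::ab_group_add, 'z) tri_cat_scheme \<Rightarrow> 'o \<Rightarrow> 'o set" where
  "thick T M = \<Inter> {U. thick_subcategory T U \<and> M \<in> U}"

definition silt :: "('k, 'o, 'm::ab_group_add, 'z) tri_cat_scheme \<Rightarrow> 'o set" where
  "silt T = {M. (\<forall>i>0. Hom T M (shift T i M) = {0}) \<and> thick T M = UNIV}"

text \<open>
  Only used with both arguments silting; \<open>\<nu>\<^sub>d\<^sup>-\<^sup>1 M\<close> is silting whenever \<open>M\<close> is.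
\<close>

definition silt_ge :: "('k, 'o, 'm::ab_group_add, 'z) tri_cat_scheme \<Rightarrow> 'o \<Rightarrow> 'o \<Rightarrow> bool" where
  "silt_ge T M N \<longleftrightarrow> (\<forall>i>0. Hom T M (shift T i N) = {0})"

definition t_structure :: "('k, 'o, 'm::ab_group_add, 'z) tri_cat_scheme \<Rightarrow> 'o set \<Rightarrow> 'o set \<Rightarrow> bool" where
  "t_structure T U V \<longleftrightarrow>
     iso_closed T U \<and> iso_closed T V \<and>
     (\<forall>X \<in> U. shift T 1 X \<in> U) \<and>
     (\<forall>Y \<in> V. shift T (-1) Y \<in> V) \<and>
     (\<forall>X \<in> U. \<forall>Y \<in> V. Hom T X (shift T (-1) Y) = {0}) \<and>
     (\<forall>X. \<exists>A \<in> U. \<exists>B \<in> V. \<exists>f g h. distinguished T A X (shift T (-1) B) f g h)"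

definition T_le0 :: "('k, 'o, 'm::ab_group_add, 'z) tri_cat_scheme \<Rightarrow> 'o \<Rightarrow> 'o set" where
  "T_le0 T M = {X. \<forall>i>0. Hom T M (shift T i X) = {0}}"

definition T_ge0 :: "('k, 'o, 'm::ab_group_add, 'z) tri_cat_scheme \<Rightarrow> 'o \<Rightarrow> 'o set" where
  "T_ge0 T M = {X. \<forall>i<0. Hom T M (shift T i X) = {0}}"

definition heart :: "('k, 'o, 'm::ab_group_add, 'z) tri_cat_scheme \<Rightarrow> 'o \<Rightarrow> 'o set" where
  "heart T M = T_le0 T M \<inter> T_ge0 T M"

text \<open>Monomorphisms and simple objects of the full subcategory with set of objects \<open>H\<close>.\<close>

definition mono_in :: "('k, 'o, 'm, 'z) lin_cat_scheme \<Rightarrow> 'o set \<Rightarrow> 'o \<Rightarrow> 'o \<Rightarrow> 'm \<Rightarrow> bool" where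
  "mono_in C H X Y f \<longleftrightarrow> X \<in> H \<and> Y \<in> H \<and> f \<in> Hom C X Y \<and>
     (\<forall>W \<in> H. \<forall>g \<in> Hom C W X. \<forall>h \<in> Hom C W X. f \<cdot>\<^bsub>C\<^esub> g = f \<cdot>\<^bsub>C\<^esub> h \<longrightarrow> g = h)"

definition simple_in :: "('k, 'o, 'm::ab_group_add, 'z) lin_cat_scheme \<Rightarrow> 'o set \<Rightarrow> 'o \<Rightarrow> bool" where
  "simple_in C H S \<longleftrightarrow> S \<in> H \<and> \<not> zero_object C S \<and>
     (\<forall>X f. mono_in C H X S f \<longrightarrow> zero_object C X \<or> is_iso C X S f)"

text \<open>
  \<open>\<nu>\<^sub>d\<^sup>-\<^sup>1 = [d] \<circ> \<nu>\<^sup>-\<^sup>1\<close> on objects, for a quasi-inverse \<open>\<nu>i\<close> of \<open>\<nu>\<close>; this is inverse to \<open>\<nu>\<^sub>d = \<nu> \<circ> [-d]\<close>.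
\<close>

definition nu_d_inv :: "('k, 'o, 'm, 'z) tri_cat_scheme \<Rightarrow> ('o, 'm) endofunctor \<Rightarrow> int \<Rightarrow> 'o \<Rightarrow> 'o" where
  "nu_d_inv T \<nu>i d X = shift T d (on_obj \<nu>i X)"

definition nu_d_finite ::
  "('k, 'o, 'm::ab_group_add, 'z) tri_cat_scheme \<Rightarrow> ('o, 'm) endofunctor \<Rightarrow> int \<Rightarrow> bool" where
  "nu_d_finite T \<nu>i d \<longleftrightarrow>
     (\<forall>X Y. \<exists>N::nat. \<forall>i\<ge>N. \<forall>j::int. 0 \<le> j \<longrightarrow> Hom T X (shift T j ((nu_d_inv T \<nu>i d ^^ i) Y)) = {0})"

end

(*
  Let F = nu_d^{-1}, and call f : X -> Y an H^0-epimorphism if g f = 0 implies g = 0 for all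
  g : Y -> Z with Z in the coaisle. Since M >= F M, Serre duality shows that F preserves the aisle
  and nu_d preserves the coaisle, so F preserves H^0-epimorphisms. If Hom(S', S[d]) is nonzero, then
  by Serre duality there is a nonzero morphism F S -> S', and it is an H^0-epimorphism as S' is
  simple in the heart. Around a cycle these compose to H^0-epimorphisms F^k S -> S'' with S'' simple
  and k arbitrarily large. But nu_d-finiteness puts F^k S into the aisle shifted by 1 for large k,
  so that every morphism F^k S -> S'' vanishes.
*)
theory Submission
  imports Defs
begin

section \<open>Morphism calculus in a linear category\<close>

context linear_category
begin

sublocale vector_space "Scale C"
  by (rule vector_space_Scale)

lemma zero_in_Hom [simp]: "0 \<in> Hom C X Y"
  using subspace_Hom subspace_0 by blast

lemma uminus_in_Hom: "f \<in> Hom C X Y \<Longrightarrow> - f \<in> Hom C X Y"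
  using subspace_Hom subspace_neg by blast

lemma Comp_zero_right: "g \<in> Hom C Y Z \<Longrightarrow> g \<cdot> 0 = 0"
  using Comp_add_right[of 0 _ Y 0 g Z] by simp

lemma Comp_zero_left: "f \<in> Hom C X Y \<Longrightarrow> 0 \<cdot> f = 0"
  using Comp_add_left[of f X Y 0 _ 0] by simp

lemma Comp_uminus_left: "\<lbrakk>f \<in> Hom C X Y; g \<in> Hom C Y Z\<rbrakk> \<Longrightarrow> (- g) \<cdot> f = - (g \<cdot> f)"
  using Comp_add_left[of f X Y g Z "- g"] uminus_in_Hom[of g Y Z] Comp_zero_left[of f X Y]
  by (simp add: eq_neg_iff_add_eq_0 add.commute)

lemma Comp_uminus_right: "\<lbrakk>f \<in> Hom C X Y; g \<in> Hom C Y Z\<rbrakk> \<Longrightarrow> g \<cdot> (- f) = - (g \<cdot> f)"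
  using Comp_add_right[of f X Y "- f" g Z] uminus_in_Hom[of f X Y] Comp_zero_right[of g Y Z]
  by (simp add: eq_neg_iff_add_eq_0 add.commute)

lemma iso_cancel_right:
  assumes "is_iso C X Y t" "g \<in> Hom C Y Z" "g \<cdot> t = 0"
  shows "g = 0"
proof -
  obtain s where s: "s \<in> Hom C Y X" "t \<cdot> s = Ident C Y" and t: "t \<in> Hom C X Y"
    using assms(1) unfolding is_iso_def by blast
  have "g = (g \<cdot> t) \<cdot> s"
    using Comp_assoc[OF s(1) t assms(2)] Comp_Id_right[OF assms(2)] s(2) by simp
  then show ?thesis
    using assms(3) Comp_zero_left[OF s(1)] by simp
qed

lemma iso_cancel_left:
  assumes "is_iso C Y Z t" "g \<in> Hom C X Y" "t \<cdot> g = 0"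
  shows "g = 0"
proof -
  obtain s where s: "s \<in> Hom C Z Y" "s \<cdot> t = Ident C Y" and t: "t \<in> Hom C Y Z"
    using assms(1) unfolding is_iso_def by blast
  have "g = s \<cdot> (t \<cdot> g)"
    using Comp_assoc[OF assms(2) t s(1)] Comp_Id_left[OF assms(2)] s(2) by simp
  then show ?thesis
    using assms(3) Comp_zero_right[OF s(1)] by simp
qed

lemma iso_inverse:
  assumes "is_iso C X Y t"
  obtains s where "is_iso C Y X s" "s \<cdot> t = Ident C X" "t \<cdot> s = Ident C Y"
  using assms that unfolding is_iso_def by blast

lemma zero_object_iff: "zero_object C Z \<longleftrightarrow> Ident C Z = 0"
proof
  assume "Ident C Z = 0"
  then have "f = 0" if "f \<in> Hom C X Z" for f X
    using Comp_Id_left[OF that] Comp_zero_left[OF that] by simp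
  moreover have "f = 0" if "f \<in> Hom C Z X" for f X
    using \<open>Ident C Z = 0\<close> Comp_Id_right[OF that] Comp_zero_right[OF that] by simp
  ultimately show "zero_object C Z"
    unfolding zero_object_def using zero_in_Hom by blast
qed (use Id_in in \<open>auto simp: zero_object_def\<close>)

section \<open>Linear functors and their quasi-inverses\<close>

lemma linear_functor_zero:
  assumes "linear_functor C F"
  shows "on_mor F 0 = 0"
proof -
  have "on_mor F (0 + 0) = on_mor F 0 + on_mor F 0"
    using assms zero_in_Hom unfolding linear_functor_def by blast
  then show ?thesis by simp
qed

lemma linear_functor_in:
  "\<lbrakk>linear_functor C F; f \<in> Hom C X Y\<rbrakk> \<Longrightarrow> on_mor F f \<in> Hom C (on_obj F X) (on_obj F Y)"
  unfolding linear_functor_def by blast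

lemma linear_functor_Comp:
  "\<lbrakk>linear_functor C F; f \<in> Hom C X Y; g \<in> Hom C Y Z\<rbrakk>
    \<Longrightarrow> on_mor F (g \<cdot> f) = on_mor F g \<cdot> on_mor F f"
  unfolding linear_functor_def by blast

lemma quasi_inverse_sym: "quasi_inverse C F G \<Longrightarrow> quasi_inverse C G F"
  unfolding quasi_inverse_def by blast

lemma quasi_inverse_functors:
  assumes "quasi_inverse C F G"
  shows "linear_functor C F" "linear_functor C G"
  using assms unfolding quasi_inverse_def by blast+

lemma quasi_inverse_counit:
  assumes "quasi_inverse C F G"
  shows "\<exists>t. (\<forall>X. is_iso C (on_obj G (on_obj F X)) X (t X)) \<and>
    (\<forall>X Y. \<forall>f \<in> Hom C X Y. t Y \<cdot> on_mor G (on_mor F f) = f \<cdot> t X)"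
proof -
  have "naturally_isomorphic C (comp_functor G F) id_functor"
    using assms unfolding quasi_inverse_def by blast
  then show ?thesis
    unfolding naturally_isomorphic_def comp_functor_def id_functor_def by simp
qed

lemma linear_functor_faithful:
  assumes "quasi_inverse C F G" "f \<in> Hom C X Y" "on_mor F f = 0"
  shows "f = 0"
proof -
  obtain t where t: "\<And>X. is_iso C (on_obj G (on_obj F X)) X (t X)"
    and nat: "\<And>X Y f. f \<in> Hom C X Y \<Longrightarrow> t Y \<cdot> on_mor G (on_mor F f) = f \<cdot> t X"
    using quasi_inverse_counit[OF assms(1)] by blast
  have "on_mor G 0 = 0"
    using assms(1) linear_functor_zero unfolding quasi_inverse_def by blast
  moreover have "t Y \<in> Hom C (on_obj G (on_obj F Y)) Y"
    using t unfolding is_iso_def by blast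
  ultimately have "f \<cdot> t X = 0"
    using nat[OF assms(2)] assms(3) Comp_zero_right by metis
  then show ?thesis
    using iso_cancel_right[OF t assms(2)] by blast
qed

text \<open>The unit is obtained by inverting, object by object, the natural isomorphism from F G to
  the identity; naturality of the inverses follows by composing each naturality square with them on
  both sides.\<close>

lemma quasi_inverse_unit:
  assumes "quasi_inverse C F G"
  shows "\<exists>\<eta>. (\<forall>X. is_iso C X (on_obj F (on_obj G X)) (\<eta> X)) \<and>
    (\<forall>X Y. \<forall>f \<in> Hom C X Y. on_mor F (on_mor G f) \<cdot> \<eta> X = \<eta> Y \<cdot> f)"
proof -
  obtain t where t: "\<And>X. is_iso C (on_obj F (on_obj G X)) X (t X)"
    and nat: "\<And>X Y f. f \<in> Hom C X Y \<Longrightarrow> t Y \<cdot> on_mor F (on_mor G f) = f \<cdot> t X"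
    using quasi_inverse_counit[OF quasi_inverse_sym[OF assms]] by blast
  have "\<forall>X. \<exists>s. is_iso C X (on_obj F (on_obj G X)) s \<and>
      s \<cdot> t X = Ident C (on_obj F (on_obj G X)) \<and> t X \<cdot> s = Ident C X"
    using iso_inverse[OF t] by metis
  then obtain s where s: "\<And>X. is_iso C X (on_obj F (on_obj G X)) (s X)"
    and st: "\<And>X. s X \<cdot> t X = Ident C (on_obj F (on_obj G X))" "\<And>X. t X \<cdot> s X = Ident C X"
    by metis
  have "on_mor F (on_mor G f) \<cdot> s X = s Y \<cdot> f" if f: "f \<in> Hom C X Y" for f X Y
  proof -
    have FG: "on_mor F (on_mor G f) \<in> Hom C (on_obj F (on_obj G X)) (on_obj F (on_obj G Y))"
      using linear_functor_in f quasi_inverse_functors[OF assms] by blast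
    have tH: "t X \<in> Hom C (on_obj F (on_obj G X)) X" "t Y \<in> Hom C (on_obj F (on_obj G Y)) Y"
      and sH: "s X \<in> Hom C X (on_obj F (on_obj G X))" "s Y \<in> Hom C Y (on_obj F (on_obj G Y))"
      using s t unfolding is_iso_def by auto
    have "on_mor F (on_mor G f) \<cdot> s X = s Y \<cdot> (t Y \<cdot> on_mor F (on_mor G f)) \<cdot> s X"
      using Comp_assoc[OF FG tH(2) sH(2)] Comp_Id_left[OF FG] st(1) by metis
    also have "\<dots> = s Y \<cdot> (f \<cdot> t X \<cdot> s X)"
      using nat[OF f] Comp_assoc[OF sH(1) Comp_in[OF tH(1) f] sH(2)] by simp
    also have "f \<cdot> t X \<cdot> s X = f"
      using Comp_assoc[OF sH(1) tH(1) f] st(2) Comp_Id_right[OF f] by simp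
    finally show ?thesis .
  qed
  with s show ?thesis by blast
qed

text \<open>Only vanishing is compared, so it suffices that f \<mapsto> F f \<cdot> \<eta> and g
  \<mapsto> \<epsilon> \<cdot> G g send nonzero morphisms to nonzero ones. This follows from
  faithfulness and from cancelling the isomorphisms.\<close>

lemma Hom_adjunct_eq_0_iff:
  assumes "quasi_inverse C F G"
  shows "Hom C (on_obj G X) Y = {0} \<longleftrightarrow> Hom C X (on_obj F Y) = {0}"
proof -
  obtain \<eta> where \<eta>: "\<And>X. is_iso C X (on_obj F (on_obj G X)) (\<eta> X)"
    and "\<And>X Y f. f \<in> Hom C X Y \<Longrightarrow> on_mor F (on_mor G f) \<cdot> \<eta> X = \<eta> Y \<cdot> f"
    using quasi_inverse_unit[OF assms] by blast
  obtain \<epsilon> where \<epsilon>: "\<And>X. is_iso C (on_obj G (on_obj F X)) X (\<epsilon> X)"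
    and "\<And>X Y f. f \<in> Hom C X Y \<Longrightarrow> \<epsilon> Y \<cdot> on_mor G (on_mor F f) = f \<cdot> \<epsilon> X"
    using quasi_inverse_counit[OF assms] by blast
  have F: "on_mor F f \<in> Hom C (on_obj F X) (on_obj F Y)" if "f \<in> Hom C X Y" for f X Y
    using linear_functor_in that quasi_inverse_functors[OF assms] by blast
  have G: "on_mor G f \<in> Hom C (on_obj G X) (on_obj G Y)" if "f \<in> Hom C X Y" for f X Y
    using linear_functor_in that quasi_inverse_functors[OF assms] by blast
  have "f = 0" if *: "Hom C X (on_obj F Y) = {0}" and f: "f \<in> Hom C (on_obj G X) Y" for f
  proof -
    have "on_mor F f \<cdot> \<eta> X \<in> Hom C X (on_obj F Y)"
      using Comp_in F[OF f] \<eta> unfolding is_iso_def by blast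
    then have "on_mor F f \<cdot> \<eta> X = 0"
      using * by blast
    then have "on_mor F f = 0"
      using iso_cancel_right[OF \<eta> F[OF f]] by blast
    then show ?thesis
      using linear_functor_faithful[OF assms f] by blast
  qed
  moreover have "g = 0" if *: "Hom C (on_obj G X) Y = {0}" and g: "g \<in> Hom C X (on_obj F Y)" for g
  proof -
    have "\<epsilon> Y \<cdot> on_mor G g \<in> Hom C (on_obj G X) Y"
      using Comp_in G[OF g] \<epsilon> unfolding is_iso_def by blast
    then have "\<epsilon> Y \<cdot> on_mor G g = 0"
      using * by blast
    then have "on_mor G g = 0"
      using iso_cancel_left[OF \<epsilon> G[OF g]] by blast
    then show ?thesis
      using linear_functor_faithful[OF quasi_inverse_sym[OF assms] g] by blast
  qed
  ultimately show ?thesis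
    using zero_in_Hom by blast
qed

section \<open>Duals of Hom spaces and Serre duality\<close>

lemma dual_trivial_iff: "dual C (Hom C X Y) = {\<lambda>_. 0} \<longleftrightarrow> Hom C X Y = {0}"
proof
  assume *: "Hom C X Y = {0}"
  have "\<phi> = (\<lambda>_. 0)" if \<phi>: "\<phi> \<in> dual C (Hom C X Y)" for \<phi>
  proof
    fix x
    have "\<phi> (0 + 0) = \<phi> 0 + \<phi> 0"
      using \<phi> zero_in_Hom[of X Y] unfolding dual_def by blast
    then have "\<phi> 0 = 0" by (metis add.right_neutral add_left_cancel)
    then show "\<phi> x = 0"
      using \<phi> * unfolding dual_def by (cases "x = 0") simp_all
  qed
  then show "dual C (Hom C X Y) = {\<lambda>_. 0}"
    by (auto simp: dual_def)
next
  assume *: "dual C (Hom C X Y) = {\<lambda>_. 0}"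
  have "x = 0" if x: "x \<in> Hom C X Y" for x
  proof (rule ccontr)
    assume "x \<noteq> 0"
    then have ind: "independent {x}" by simp
    define B where "B = extend_basis {x}"
    have B: "independent B" "span B = UNIV" "x \<in> B"
      using independent_extend_basis[OF ind] span_extend_basis[OF ind] extend_basis_superset[OF ind]
      unfolding B_def by auto
    \<comment> \<open>The coordinate functional of x in a basis containing x, cut off outside the
      Hom space as \<open>dual\<close> requires; its value at x is 1.\<close>
    define \<phi> where "\<phi> y = (if y \<in> Hom C X Y then representation B y x else 0)" for y
    have "\<phi> \<in> dual C (Hom C X Y)"
      unfolding dual_def \<phi>_def
      using B subspace_add[OF subspace_Hom] subspace_scale[OF subspace_Hom]
      by (simp add: representation_add representation_scale)
    then have "\<phi> x = 0" using * by auto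
    then show False
      using B x representation_basis[OF B(1,3)] by (simp add: \<phi>_def)
  qed
  then show "Hom C X Y = {0}"
    using zero_in_Hom by blast
qed

text \<open>The Serre bijection matches one-element sets with one-element sets, and a dual is
  trivial exactly when the space is. All later appeals to Serre duality go through this
  equivalence.\<close>

lemma serre_Hom_eq_0_iff:
  assumes "serre_functor C \<nu>"
  shows "Hom C Y (on_obj \<nu> X) = {0} \<longleftrightarrow> Hom C X Y = {0}"
proof -
  obtain \<phi> where "\<forall>X Y. bij_betw (\<phi> X Y) (Hom C X Y) (dual C (Hom C Y (on_obj \<nu> X)))"
    using assms unfolding serre_functor_def by (elim conjE exE) simp
  then have bij: "bij_betw (\<phi> X Y) (Hom C X Y) (dual C (Hom C Y (on_obj \<nu> X)))"
    by blast
  have 0: "(\<lambda>_. 0) \<in> dual C (Hom C Y (on_obj \<nu> X))"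
    by (simp add: dual_def)
  show ?thesis
  proof
    assume "Hom C Y (on_obj \<nu> X) = {0}"
    then have "dual C (Hom C Y (on_obj \<nu> X)) = {\<lambda>_. 0}"
      using dual_trivial_iff by blast
    then have "f = 0" if "f \<in> Hom C X Y" for f
      using bij_betwE[OF bij] bij_betw_imp_inj_on[OF bij] that zero_in_Hom[of X Y]
      by (metis inj_onD singletonD)
    then show "Hom C X Y = {0}"
      using zero_in_Hom by blast
  next
    assume "Hom C X Y = {0}"
    \<comment> \<open>The dual has a single element, and the zero functional belongs to it.\<close>
    then have "dual C (Hom C Y (on_obj \<nu> X)) = {\<phi> X Y 0}"
      using bij unfolding bij_betw_def by auto
    with 0 have "dual C (Hom C Y (on_obj \<nu> X)) = {\<lambda>_. 0}"
      by auto
    then show "Hom C Y (on_obj \<nu> X) = {0}"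
      using dual_trivial_iff by blast
  qed
qed

end

section \<open>Epimorphisms tested against a class of objects\<close>

definition epi_wrt ::
  "('k, 'o, 'm::zero, 'z) lin_cat_scheme \<Rightarrow> 'o set \<Rightarrow> 'o \<Rightarrow> 'o \<Rightarrow> 'm \<Rightarrow> bool" where
  "epi_wrt C V X Y f \<longleftrightarrow> f \<in> Hom C X Y \<and> (\<forall>Z \<in> V. \<forall>g \<in> Hom C Y Z. g \<cdot>\<^bsub>C\<^esub> f = 0 \<longrightarrow> g = 0)"

context linear_category
begin

lemma epi_wrt_Comp:
  assumes "epi_wrt C V X Y f" "epi_wrt C V Y Z g"
  shows "epi_wrt C V X Z (g \<cdot> f)"
proof -
  have f: "f \<in> Hom C X Y" and g: "g \<in> Hom C Y Z"
    using assms unfolding epi_wrt_def by blast+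
  have "h = 0" if W: "W \<in> V" and h: "h \<in> Hom C Z W" and 0: "h \<cdot> (g \<cdot> f) = 0" for W h
  proof -
    have "(h \<cdot> g) \<cdot> f = 0"
      using 0 Comp_assoc[OF f g h] by simp
    then have "h \<cdot> g = 0"
      using assms(1) W Comp_in[OF g h] unfolding epi_wrt_def by blast
    then show ?thesis
      using assms(2) W h unfolding epi_wrt_def by blast
  qed
  then show ?thesis
    using Comp_in[OF f g] unfolding epi_wrt_def by blast
qed

lemma epi_wrt_Ident: "epi_wrt C V X X (Ident C X)"
  using Id_in Comp_Id_right unfolding epi_wrt_def by metis

text \<open>G acts as a left adjoint of F: testing G f against Z amounts to testing f against F Z.
  Hence the test class is replaced by its preimage under F.\<close>

lemma epi_wrt_functor:
  assumes qi: "quasi_inverse C F G" and f: "epi_wrt C V X Y f"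
  shows "epi_wrt C {Z. on_obj F Z \<in> V} (on_obj G X) (on_obj G Y) (on_mor G f)"
proof -
  have fH: "f \<in> Hom C X Y" using f unfolding epi_wrt_def by blast
  then have GH: "on_mor G f \<in> Hom C (on_obj G X) (on_obj G Y)"
    using linear_functor_in quasi_inverse_functors[OF qi] by blast
  obtain \<eta> where \<eta>: "\<And>X. is_iso C X (on_obj F (on_obj G X)) (\<eta> X)"
    and nat: "\<And>X Y f. f \<in> Hom C X Y \<Longrightarrow> on_mor F (on_mor G f) \<cdot> \<eta> X = \<eta> Y \<cdot> f"
    using quasi_inverse_unit[OF qi] by blast
  have \<eta>H: "\<eta> X \<in> Hom C X (on_obj F (on_obj G X))" for X
    using \<eta> unfolding is_iso_def by blast
  have "g = 0" if Z: "on_obj F Z \<in> V" and g: "g \<in> Hom C (on_obj G Y) Z"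
    and gf: "g \<cdot> on_mor G f = 0" for g Z
  proof -
    have Fg: "on_mor F g \<in> Hom C (on_obj F (on_obj G Y)) (on_obj F Z)"
      and FGf: "on_mor F (on_mor G f) \<in> Hom C (on_obj F (on_obj G X)) (on_obj F (on_obj G Y))"
      and comp: "on_mor F (g \<cdot> on_mor G f) = on_mor F g \<cdot> on_mor F (on_mor G f)"
      using g GH qi by (simp_all add: quasi_inverse_functors linear_functor_in linear_functor_Comp)
    have "on_mor F 0 = 0"
      using qi linear_functor_zero unfolding quasi_inverse_def by blast
    then have 0: "on_mor F g \<cdot> on_mor F (on_mor G f) = 0"
      using comp gf by simp
    have "(on_mor F g \<cdot> \<eta> Y) \<cdot> f = (on_mor F g \<cdot> on_mor F (on_mor G f)) \<cdot> \<eta> X"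
      using Comp_assoc[OF fH \<eta>H Fg] Comp_assoc[OF \<eta>H FGf Fg] nat[OF fH] by simp
    also have "\<dots> = 0"
      using 0 Comp_zero_left[OF \<eta>H] by simp
    finally have "on_mor F g \<cdot> \<eta> Y = 0"
      using f Z Comp_in[OF \<eta>H Fg] unfolding epi_wrt_def by blast
    then have "on_mor F g = 0"
      using iso_cancel_right[OF \<eta> Fg] by blast
    then show ?thesis
      using linear_functor_faithful[OF qi g] by blast
  qed
  with GH show ?thesis
    unfolding epi_wrt_def by blast
qed

end

section \<open>Integer shifts and their action on Hom spaces\<close>

context triangulated_category
begin

lemma ex_zero_object: "\<exists>Z. zero_object T Z"
proof -
  \<comment> \<open>The empty biproduct: its identity is an empty sum.\<close>
  obtain Z i p where "biproduct T 0 (\<lambda>_. undefined) Z i p"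
    using ex_biproduct by blast
  then have "Ident T Z = 0"
    unfolding biproduct_def by simp
  then show ?thesis using zero_object_iff by blast
qed

lemma suspM_in: "f \<in> Hom T X Y \<Longrightarrow> suspM T f \<in> Hom T (suspO T X) (suspO T Y)"
  using susp_functor unfolding linear_functor_def by blast

lemma suspM_Comp:
  "\<lbrakk>f \<in> Hom T X Y; g \<in> Hom T Y Z\<rbrakk> \<Longrightarrow> suspM T (g \<cdot> f) = suspM T g \<cdot> suspM T f"
  using susp_functor unfolding linear_functor_def by blast

lemma suspM_zero: "suspM T 0 = 0"
  using susp_functor linear_functor_zero by blast

lemma suspM_inject:
  "\<lbrakk>f \<in> Hom T X Y; g \<in> Hom T X Y; suspM T f = suspM T g\<rbrakk> \<Longrightarrow> f = g"
  using bij_suspM[of X Y] unfolding bij_betw_def inj_on_def by blast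

lemma suspM_Ident: "suspM T (Ident T X) = Ident T (suspO T X)"
  using susp_functor unfolding linear_functor_def by blast

lemma shift_0 [simp]: "shift T 0 X = X"
  by (simp add: shift_def)

lemma suspO_shift: "suspO T (shift T n X) = shift T (n + 1) X"
proof (cases "0 \<le> n")
  case True
  then have "nat (n + 1) = Suc (nat n)" by simp
  then show ?thesis using True by (simp add: shift_def)
next
  case False
  then have "nat (- n) = Suc (nat (- (n + 1)))" by simp
  then have "shift T n X = inv (suspO T) ((inv (suspO T) ^^ nat (- (n + 1))) X)"
    using False unfolding shift_def by simp
  moreover have "suspO T (inv (suspO T) Y) = Y" for Y
    using bij_suspO by (simp add: bij_is_surj surj_f_inv_f)
  moreover have "shift T (n + 1) X = (inv (suspO T) ^^ nat (- (n + 1))) X"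
    using False by (cases "n = -1") (auto simp: shift_def)
  ultimately show ?thesis by simp
qed

lemma shift_shift [simp]: "shift T m (shift T n X) = shift T (m + n) X"
proof (induction m rule: int_induct[of _ 0])
  case (step1 i)
  then show ?case
    using suspO_shift[of i "shift T n X"] suspO_shift[of "i + n" X] by (simp add: algebra_simps)
next
  case (step2 i)
  have "suspO T (shift T (i - 1) (shift T n X)) = suspO T (shift T (i - 1 + n) X)"
    using step2 by (simp add: suspO_shift algebra_simps)
  then show ?case
    using bij_suspO by (simp add: bij_is_inj inj_eq)
qed simp

lemma suspO_eq_shift: "suspO T X = shift T 1 X"
  using suspO_shift[of 0 X] by simp

text \<open>
  Hom spaces may overlap, so a negative shift has no well-defined action on bare elements of \<open>'m\<close>;
  hence the action is a family indexed by source and target.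
\<close>

lemma shift_on_morphisms:
  "\<exists>\<sigma>. (\<forall>X Y. bij_betw (\<sigma> X Y) (Hom T X Y) (Hom T (shift T n X) (shift T n Y))) \<and>
       (\<forall>X Y Z. \<forall>f \<in> Hom T X Y. \<forall>g \<in> Hom T Y Z. \<sigma> X Z (g \<cdot> f) = \<sigma> Y Z g \<cdot> \<sigma> X Y f) \<and>
       (\<forall>X Y. \<sigma> X Y 0 = 0)"
proof (induction n rule: int_induct[of _ 0])
  case base
  show ?case
    by (rule exI[of _ "\<lambda>_ _ f. f"]) (auto simp: bij_betw_def)
next
  case (step1 n)
  then obtain \<sigma> where bij: "\<And>X Y. bij_betw (\<sigma> X Y) (Hom T X Y) (Hom T (shift T n X) (shift T n Y))"
    and comp: "\<And>X Y Z f g. \<lbrakk>f \<in> Hom T X Y; g \<in> Hom T Y Z\<rbrakk> \<Longrightarrow> \<sigma> X Z (g \<cdot> f) = \<sigma> Y Z g \<cdot> \<sigma> X Y f"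
    and zero: "\<And>X Y. \<sigma> X Y 0 = 0"
    by blast
  let ?\<sigma> = "\<lambda>X Y f. suspM T (\<sigma> X Y f)"
  have "bij_betw (?\<sigma> X Y) (Hom T X Y) (Hom T (shift T (n + 1) X) (shift T (n + 1) Y))" for X Y
    using bij_betw_trans[OF bij[of X Y] bij_suspM] by (simp add: suspO_shift comp_def)
  moreover have "?\<sigma> X Z (g \<cdot> f) = ?\<sigma> Y Z g \<cdot> ?\<sigma> X Y f"
    if "f \<in> Hom T X Y" "g \<in> Hom T Y Z" for X Y Z f g
    using that comp suspM_Comp bij_betwE[OF bij] by metis
  ultimately show ?case
    using zero suspM_zero by (intro exI[of _ ?\<sigma>]) simp
next
  case (step2 n)
  then obtain \<sigma> where bij: "\<And>X Y. bij_betw (\<sigma> X Y) (Hom T X Y) (Hom T (shift T n X) (shift T n Y))"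
    and comp: "\<And>X Y Z f g. \<lbrakk>f \<in> Hom T X Y; g \<in> Hom T Y Z\<rbrakk> \<Longrightarrow> \<sigma> X Z (g \<cdot> f) = \<sigma> Y Z g \<cdot> \<sigma> X Y f"
    and zero: "\<And>X Y. \<sigma> X Y 0 = 0"
    by blast
  let ?H = "\<lambda>X Y. Hom T (shift T (n - 1) X) (shift T (n - 1) Y)"
  \<comment> \<open>Desuspend inside the one Hom space on which \<open>suspM\<close> is known to be
    injective; compatibility with composition is then checked after suspending again.\<close>
  let ?\<sigma> = "\<lambda>X Y f. inv_into (?H X Y) (suspM T) (\<sigma> X Y f)"
  have susp: "bij_betw (suspM T) (?H X Y) (Hom T (shift T n X) (shift T n Y))" for X Y
    using bij_suspM[of "shift T (n - 1) X" "shift T (n - 1) Y"] by (simp add: suspO_shift)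
  have bij': "bij_betw (?\<sigma> X Y) (Hom T X Y) (?H X Y)" for X Y
    using bij_betw_trans[OF bij[of X Y] bij_betw_inv_into[OF susp]] by (simp add: comp_def)
  have lift: "suspM T (?\<sigma> X Y f) = \<sigma> X Y f" if "f \<in> Hom T X Y" for X Y f
    using bij_betw_inv_into_right[OF susp] bij_betwE[OF bij] that by blast
  have "?\<sigma> X Z (g \<cdot> f) = ?\<sigma> Y Z g \<cdot> ?\<sigma> X Y f"
    if f: "f \<in> Hom T X Y" and g: "g \<in> Hom T Y Z" for X Y Z f g
  proof (rule suspM_inject)
    have *: "?\<sigma> X Y f \<in> ?H X Y" "?\<sigma> Y Z g \<in> ?H Y Z"
      using bij_betwE[OF bij'] f g by blast+
    show "?\<sigma> X Z (g \<cdot> f) \<in> ?H X Z"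
      using bij_betwE[OF bij'] Comp_in[OF f g] by blast
    show "?\<sigma> Y Z g \<cdot> ?\<sigma> X Y f \<in> ?H X Z"
      using Comp_in[OF *] .
    show "suspM T (?\<sigma> X Z (g \<cdot> f)) = suspM T (?\<sigma> Y Z g \<cdot> ?\<sigma> X Y f)"
      using suspM_Comp[OF *] lift[OF f] lift[OF g] lift[OF Comp_in[OF f g]] comp[OF f g] by simp
  qed
  moreover have "?\<sigma> X Y 0 = 0" for X Y
    using bij_betw_inv_into_left[OF susp zero_in_Hom, of X Y] zero suspM_zero by simp
  ultimately show ?case
    using bij' by (intro exI[of _ ?\<sigma>]) simp
qed

lemma Hom_shift_eq_0_iff: "Hom T (shift T n X) (shift T n Y) = {0} \<longleftrightarrow> Hom T X Y = {0}"
proof -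
  obtain \<sigma> where bij: "bij_betw (\<sigma> X Y) (Hom T X Y) (Hom T (shift T n X) (shift T n Y))"
    and zero: "\<sigma> X Y 0 = 0"
    using shift_on_morphisms by metis
  have "Hom T X Y = {0}" if "Hom T (shift T n X) (shift T n Y) = {0}"
  proof -
    have "f = 0" if "f \<in> Hom T X Y" for f
      using bij_betwE[OF bij] bij_betw_imp_inj_on[OF bij] \<open>_ = {0}\<close> that zero zero_in_Hom[of X Y]
      by (metis inj_onD singletonD)
    then show ?thesis using zero_in_Hom by blast
  qed
  moreover have "Hom T (shift T n X) (shift T n Y) = {0}" if "Hom T X Y = {0}"
    using bij zero that unfolding bij_betw_def by auto
  ultimately show ?thesis by blast
qed

lemma Hom_shift_left_eq_0_iff: "Hom T (shift T n X) Y = {0} \<longleftrightarrow> Hom T X (shift T (- n) Y) = {0}"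
  using Hom_shift_eq_0_iff[of n X "shift T (- n) Y"] by simp

text \<open>The analogue of \<open>epi_wrt_functor\<close> for [n] with inverse [-n]. The action of
  [n] on morphisms is a family indexed by objects rather than an \<open>endofunctor\<close>, so the
  argument is repeated with that family.\<close>

lemma epi_wrt_shift:
  assumes "epi_wrt T V X Y f"
  shows "\<exists>f'. epi_wrt T {Z. shift T (- n) Z \<in> V} (shift T n X) (shift T n Y) f'"
proof -
  obtain \<sigma> where bij: "\<And>X Y. bij_betw (\<sigma> X Y) (Hom T X Y) (Hom T (shift T n X) (shift T n Y))"
    and comp: "\<And>X Y Z f g. \<lbrakk>f \<in> Hom T X Y; g \<in> Hom T Y Z\<rbrakk> \<Longrightarrow> \<sigma> X Z (g \<cdot> f) = \<sigma> Y Z g \<cdot> \<sigma> X Y f"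
    and zero: "\<And>X Y. \<sigma> X Y 0 = 0"
    using shift_on_morphisms[of n] by metis
  have f: "f \<in> Hom T X Y" using assms unfolding epi_wrt_def by blast
  have "g = 0" if Z: "shift T (- n) Z \<in> V" and g: "g \<in> Hom T (shift T n Y) Z"
    and 0: "g \<cdot> \<sigma> X Y f = 0" for Z g
  proof -
    let ?W = "shift T (- n) Z"
    have "g \<in> Hom T (shift T n Y) (shift T n ?W)"
      using g by simp
    then obtain g' where g': "g' \<in> Hom T Y ?W" "g = \<sigma> Y ?W g'"
      using bij[of Y ?W] unfolding bij_betw_def by blast
    then have "\<sigma> X ?W (g' \<cdot> f) = \<sigma> X ?W 0"
      using comp[OF f g'(1)] 0 zero by simp
    then have "g' \<cdot> f = 0"
      using bij[of X ?W] Comp_in[OF f g'(1)] zero_in_Hom unfolding bij_betw_def inj_on_def by blast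
    then have "g' = 0"
      using assms Z g'(1) unfolding epi_wrt_def by blast
    then show ?thesis using g'(2) zero by simp
  qed
  then have "epi_wrt T {Z. shift T (- n) Z \<in> V} (shift T n X) (shift T n Y) (\<sigma> X Y f)"
    using bij_betwE[OF bij] f unfolding epi_wrt_def by blast
  then show ?thesis by blast
qed

section \<open>Exactness of Hom on distinguished triangles\<close>

lemma distinguished_rotate:
  "distinguished T X Y Z u v w \<Longrightarrow> distinguished T Y Z (suspO T X) v w (- suspM T u)"
  using TR2 dist_Hom by blast

lemma distinguished_Comp_zero:
  assumes "distinguished T X Y Z u v w"
  shows "v \<cdot> u = 0"
proof -
  obtain N where N: "zero_object T N" using ex_zero_object by blast
  have u: "u \<in> Hom T X Y" using dist_Hom[OF assms] by blast
  \<comment> \<open>Mapping the triangle X = X \<rightarrow> 0 to the given one by the identity and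
    u factors v \<cdot> u through a zero object.\<close>
  obtain c where "c \<in> Hom T N Z" "v \<cdot> u = c \<cdot> 0"
    using TR3[OF TR1_Id[OF N] assms Id_in u] by blast
  then show ?thesis using Comp_zero_right by simp
qed

text \<open>Map the triangle W \<rightarrow> 0 \<rightarrow> W[1] to the rotated triangle Y
  \<rightarrow> Z \<rightarrow> X[1], starting with f and 0. The third map W[1] \<rightarrow> X[1]
  desuspends to f', and the signs from the rotations cancel.\<close>

lemma distinguished_exact:
  assumes "distinguished T X Y Z u v w" "f \<in> Hom T W Y" "v \<cdot> f = 0"
  obtains f' where "f' \<in> Hom T W X" "f = u \<cdot> f'"
proof -
  obtain N where N: "zero_object T N" using ex_zero_object by blast
  have u: "u \<in> Hom T X Y" using dist_Hom[OF assms(1)] by blast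
  have W: "distinguished T W N (suspO T W) 0 0 (- Ident T (suspO T W))"
    using distinguished_rotate[OF TR1_Id[OF N]] suspM_Ident by simp
  have "v \<cdot> f = 0 \<cdot> 0"
    using assms(3) Comp_zero_left[OF zero_in_Hom] by simp
  then obtain c where c: "c \<in> Hom T (suspO T W) (suspO T X)"
    "- suspM T u \<cdot> c = suspM T f \<cdot> - Ident T (suspO T W)"
    using TR3[OF W distinguished_rotate[OF assms(1)] assms(2) zero_in_Hom] by metis
  then have "suspM T u \<cdot> c = suspM T f"
    using Comp_uminus_left[OF c(1) suspM_in[OF u]] Comp_uminus_right[OF Id_in suspM_in[OF assms(2)]]
      Comp_Id_right[OF suspM_in[OF assms(2)]] by simp
  moreover obtain f' where f': "f' \<in> Hom T W X" "c = suspM T f'"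
    using c(1) bij_suspM[of W X] unfolding bij_betw_def by blast
  ultimately have "suspM T f = suspM T (u \<cdot> f')"
    using suspM_Comp[OF f'(1) u] by simp
  then show ?thesis
    using suspM_inject[OF assms(2) Comp_in[OF f'(1) u]] f'(1) that by blast
qed

text \<open>After two rotations, h[1] is killed by the map X[1] \<rightarrow> Y[1], so it factors
  through a morphism W[1] \<rightarrow> Z. Such morphisms vanish, because Hom(W[1], Z) vanishes
  together with Hom(W, Z[-1]).\<close>

lemma distinguished_mono:
  assumes tri: "distinguished T X Y Z u v w" and W: "Hom T W (shift T (-1) Z) = {0}"
    and h: "h \<in> Hom T W X" "u \<cdot> h = 0"
  shows "h = 0"
proof -
  have u: "u \<in> Hom T X Y" using dist_Hom[OF tri] by blast
  have tri': "distinguished T Z (suspO T X) (suspO T Y) w (- suspM T u) (- suspM T v)"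
    using distinguished_rotate[OF distinguished_rotate[OF tri]] .
  have w: "w \<in> Hom T Z (suspO T X)" using dist_Hom[OF tri] by blast
  have "- suspM T u \<cdot> suspM T h = 0"
    using Comp_uminus_left[OF suspM_in[OF h(1)] suspM_in[OF u]] suspM_Comp[OF h(1) u] h(2) suspM_zero
    by simp
  then obtain h' where h': "h' \<in> Hom T (suspO T W) Z" "suspM T h = w \<cdot> h'"
    using distinguished_exact[OF tri' suspM_in[OF h(1)]] by metis
  have "Hom T (suspO T W) Z = {0}"
    using W Hom_shift_left_eq_0_iff[of 1] by (simp add: suspO_eq_shift)
  then have "suspM T h = suspM T 0"
    using h' Comp_zero_right[OF w] suspM_zero by auto
  then show ?thesis
    using suspM_inject[OF h(1) zero_in_Hom] by blast
qed

lemma Hom_eq_0_left: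
  assumes tri: "distinguished T X Y Z u v w" and "Hom T W Y = {0}" "Hom T W (shift T (-1) Z) = {0}"
  shows "Hom T W X = {0}"
proof -
  have "f = 0" if f: "f \<in> Hom T W X" for f
  proof -
    have "u \<cdot> f \<in> Hom T W Y"
      using Comp_in[OF f] dist_Hom[OF tri] by blast
    then show ?thesis
      using distinguished_mono[OF tri assms(3) f] assms(2) by blast
  qed
  then show ?thesis using zero_in_Hom by blast
qed

section \<open>The t-structure attached to M\<close>

lemma T_le0_iff: "X \<in> T_le0 T M \<longleftrightarrow> (\<forall>i<0. Hom T (shift T i M) X = {0})"
proof
  assume *: "X \<in> T_le0 T M"
  show "\<forall>i<0. Hom T (shift T i M) X = {0}"
    using * unfolding T_le0_def Hom_shift_left_eq_0_iff by simp
next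
  assume *: "\<forall>i<0. Hom T (shift T i M) X = {0}"
  have "Hom T M (shift T i X) = {0}" if "0 < i" for i
    using *[rule_format, of "- i"] that by (simp add: Hom_shift_left_eq_0_iff)
  then show "X \<in> T_le0 T M" unfolding T_le0_def by blast
qed

text \<open>As in \<open>T_le0_iff\<close>, the shift is moved onto M, so that membership can be
  read off from Hom(M[i], -) on a triangle as it stands, without shifting the triangle.\<close>

lemma T_ge0_iff: "X \<in> T_ge0 T M \<longleftrightarrow> (\<forall>i>0. Hom T (shift T i M) X = {0})"
proof
  assume *: "X \<in> T_ge0 T M"
  show "\<forall>i>0. Hom T (shift T i M) X = {0}"
    using * unfolding T_ge0_def Hom_shift_left_eq_0_iff by simp
next
  assume *: "\<forall>i>0. Hom T (shift T i M) X = {0}"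
  have "Hom T M (shift T i X) = {0}" if "i < 0" for i
    using *[rule_format, of "- i"] that by (simp add: Hom_shift_left_eq_0_iff)
  then show "X \<in> T_ge0 T M" unfolding T_ge0_def by blast
qed

lemma T_ge0_shift: "\<lbrakk>X \<in> T_ge0 T M; n \<le> 0\<rbrakk> \<Longrightarrow> shift T n X \<in> T_ge0 T M"
  unfolding T_ge0_def by simp

lemma t_structure_Hom:
  "\<lbrakk>t_structure T U V; X \<in> U; Y \<in> V\<rbrakk> \<Longrightarrow> Hom T X (shift T (-1) Y) = {0}"
  unfolding t_structure_def by blast

text \<open>In the truncation triangle A \<rightarrow> X \<rightarrow> B[-1] the second map is zero,
  so every morphism M[i] \<rightarrow> X lifts to A, where it vanishes for i < 0.\<close>

lemma T_le0_if_orthogonal: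
  assumes t: "t_structure T (T_le0 T M) (T_ge0 T M)"
    and orth: "\<And>B. B \<in> T_ge0 T M \<Longrightarrow> Hom T X (shift T (-1) B) = {0}"
  shows "X \<in> T_le0 T M"
proof -
  obtain A B f g h where A: "A \<in> T_le0 T M" and B: "B \<in> T_ge0 T M"
    and tri: "distinguished T A X (shift T (-1) B) f g h"
    using t unfolding t_structure_def by blast
  have f: "f \<in> Hom T A X" and g: "g = 0"
    using dist_Hom[OF tri] orth[OF B] by auto
  have "Hom T (shift T i M) X = {0}" if "i < 0" for i
  proof -
    have "e = 0" if e: "e \<in> Hom T (shift T i M) X" for e
    proof -
      obtain e' where "e' \<in> Hom T (shift T i M) A" "e = f \<cdot> e'"
        using distinguished_exact[OF tri e] g Comp_zero_left[OF e] by metis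
      then show ?thesis
        using A \<open>i < 0\<close> Comp_zero_right[OF f] unfolding T_le0_iff by auto
    qed
    then show ?thesis using zero_in_Hom by blast
  qed
  then show ?thesis unfolding T_le0_iff by blast
qed

text \<open>
  If \<open>g \<cdot> f = 0\<close> with \<open>Z\<close> in the coaisle, then \<open>f\<close> factors through the truncation \<open>K\<close> of the fibre of
  \<open>g\<close>. This \<open>K\<close> is the kernel of \<open>g\<close> in the heart, so by simplicity it is \<open>0\<close> or \<open>S\<close>.
\<close>

lemma epi_wrt_simple:
  assumes t: "t_structure T (T_le0 T M) (T_ge0 T M)" and S: "simple_in T (heart T M) S"
    and X: "X \<in> T_le0 T M" and f: "f \<in> Hom T X S" "f \<noteq> 0"
  shows "epi_wrt T (T_ge0 T M) X S f"
proof -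
  have SV: "S \<in> T_ge0 T M" and SH: "S \<in> heart T M"
    using S unfolding simple_in_def heart_def by auto
  have "g = 0" if Z: "Z \<in> T_ge0 T M" and g: "g \<in> Hom T S Z" and gf: "g \<cdot> f = 0" for g Z
  proof -
    obtain Q v w where "distinguished T S Z Q g v w"
      using TR1_cone[OF g] by blast
    \<comment> \<open>R is the fibre of g, a desuspended cone. The sign in c is chosen so that
      \<open>TR2\<close> rotates S \<rightarrow> Z \<rightarrow> R[1] back to R \<rightarrow> S
      \<rightarrow> Z.\<close>
    moreover define R c where "R = shift T (-1) Q" and "c = inv_into (Hom T R S) (suspM T) (- w)"
    ultimately have tri0: "distinguished T S Z (suspO T R) g v w"
      by (simp add: suspO_eq_shift)
    then have w: "w \<in> Hom T (suspO T R) (suspO T S)"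
      using dist_Hom by blast
    then have "- w \<in> suspM T ` Hom T R S"
      using bij_suspM[of R S] uminus_in_Hom unfolding bij_betw_def by blast
    then have c: "c \<in> Hom T R S" "- suspM T c = w"
      unfolding c_def by (auto simp: inv_into_into f_inv_into_f)
    have tri: "distinguished T R S Z c g v"
      using TR2[of c R S g Z v] c g tri0 dist_Hom[OF tri0] by simp
    obtain K B k p q where KU: "K \<in> T_le0 T M" and BV: "B \<in> T_ge0 T M"
      and triK: "distinguished T K R (shift T (-1) B) k p q"
      using t unfolding t_structure_def by blast
    have k: "k \<in> Hom T K R" and p: "p \<in> Hom T R (shift T (-1) B)"
      using dist_Hom[OF triK] by auto
    have BV': "shift T (-1) B \<in> T_ge0 T M" and ZV': "shift T (-1) Z \<in> T_ge0 T M"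
      using BV Z T_ge0_shift[of _ M "-1"] by auto
    \<comment> \<open>R has no maps from M[i], i > 0, since S and Z[-1] have none; then neither has
      K, since R and B[-2] have none.\<close>
    have "shift T (-1) (shift T (-1) B) \<in> T_ge0 T M"
      using T_ge0_shift[OF BV', of "-1"] by simp
    then have "Hom T (shift T i M) K = {0}" if "0 < i" for i
      using that SV ZV' unfolding T_ge0_iff
      by (intro Hom_eq_0_left[OF triK] Hom_eq_0_left[OF tri]) blast+
    then have "K \<in> T_ge0 T M"
      unfolding T_ge0_iff by blast
    then have KH: "K \<in> heart T M"
      using KU unfolding heart_def by blast
    have ck: "c \<cdot> k \<in> Hom T K S"
      using Comp_in[OF k c(1)] .
    \<comment> \<open>For W in the aisle, k and c can each be cancelled from the left, because W has
      no nonzero maps to B[-2] or Z[-1]. Taking differences below turns this into the monomorphism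
      property.\<close>
    have "c \<cdot> k \<cdot> h = 0 \<Longrightarrow> h = 0" if W: "W \<in> heart T M" and h: "h \<in> Hom T W K" for W h
    proof -
      assume "c \<cdot> k \<cdot> h = 0"
      then have "c \<cdot> (k \<cdot> h) = 0"
        using Comp_assoc[OF h k c(1)] by simp
      moreover have "Hom T W (shift T (-1) Z) = {0}" "Hom T W (shift T (-1) (shift T (-1) B)) = {0}"
        using t_structure_Hom[OF t] W Z BV' unfolding heart_def by blast+
      ultimately show "h = 0"
        using distinguished_mono[OF tri _ Comp_in[OF h k]] distinguished_mono[OF triK _ h] by blast
    qed
    moreover have "c \<cdot> k \<cdot> (g' - h') = c \<cdot> k \<cdot> g' - c \<cdot> k \<cdot> h'" "g' - h' \<in> Hom T W K"
      if "g' \<in> Hom T W K" "h' \<in> Hom T W K" for W g' h'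
      using that Comp_add_right[OF that(1) uminus_in_Hom[OF that(2)] ck] Comp_uminus_right[OF that(2) ck]
        subspace_diff[OF subspace_Hom] by simp_all
    ultimately have "mono_in T (heart T M) K S (c \<cdot> k)"
      unfolding mono_in_def using KH SH ck by (metis eq_iff_diff_eq_0)
    then consider "zero_object T K" | "is_iso T K S (c \<cdot> k)"
      using S unfolding simple_in_def by blast
    then show "g = 0"
    proof cases
      \<comment> \<open>As g \<cdot> f = 0, f lifts to R; as X is in the aisle, it lifts further to
        K = 0, contradicting f \<noteq> 0.\<close>
      case 1
      obtain f' where f': "f' \<in> Hom T X R" "f = c \<cdot> f'"
        using distinguished_exact[OF tri f(1) gf] .
      have "p \<cdot> f' \<in> Hom T X (shift T (-1) B)"
        using Comp_in[OF f'(1) p] .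
      then have "p \<cdot> f' = 0"
        using t_structure_Hom[OF t X BV] by blast
      then obtain f'' where "f'' \<in> Hom T X K" "f' = k \<cdot> f''"
        using distinguished_exact[OF triK f'(1)] by metis
      then have "f = 0"
        using 1 f'(2) Comp_zero_right[OF k] Comp_zero_right[OF c(1)] unfolding zero_object_def by auto
      then show ?thesis using f(2) by blast
    next
      \<comment> \<open>Here g vanishes after composition with the isomorphism c \<cdot> k, since g
        \<cdot> c = 0.\<close>
      case 2
      have "g \<cdot> (c \<cdot> k) = 0"
        using Comp_assoc[OF k c(1) g] distinguished_Comp_zero[OF tri] Comp_zero_left[OF k] by simp
      then show ?thesis
        using iso_cancel_right[OF 2 g] by blast
    qed
  qed
  then show ?thesis
    using f(1) unfolding epi_wrt_def by blast
qed

section \<open>The action of nu_d and its inverse on the t-structure\<close>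

lemma nu_d_inv_Hom_eq_0_iff:
  assumes "quasi_inverse T \<nu> \<nu>i"
  shows "Hom T (nu_d_inv T \<nu>i d X) Y = {0} \<longleftrightarrow> Hom T X (on_obj \<nu> (shift T (- d) Y)) = {0}"
  unfolding nu_d_inv_def Hom_shift_left_eq_0_iff Hom_adjunct_eq_0_iff[OF assms] ..

text \<open>
  The Serre functor is not assumed to be a triangle functor; its compatibility with the shift at the
  level of vanishing of Hom spaces follows from Serre duality.
\<close>

lemma serre_Hom_shift_eq_0_iff:
  assumes "serre_functor T \<nu>"
  shows "Hom T X (shift T i (on_obj \<nu> Y)) = {0} \<longleftrightarrow> Hom T X (on_obj \<nu> (shift T i Y)) = {0}"
proof -
  have "Hom T X (shift T i (on_obj \<nu> Y)) = {0} \<longleftrightarrow> Hom T (shift T (- i) X) (on_obj \<nu> Y) = {0}"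
    by (simp add: Hom_shift_left_eq_0_iff)
  also have "\<dots> \<longleftrightarrow> Hom T (shift T i Y) X = {0}"
    by (simp add: serre_Hom_eq_0_iff[OF assms] Hom_shift_left_eq_0_iff)
  finally show ?thesis
    by (simp add: serre_Hom_eq_0_iff[OF assms])
qed

text \<open>nu_d^{-1} M lies in the aisle and B[i+1] in the coaisle, so Hom(nu_d^{-1} M, B[i])
  vanishes; adjunction moves nu_d to the other side, and the shift is then pulled out of \<nu>. The
  threshold c is 0 for preserving the coaisle and 1 when B is replaced by B[-1].\<close>

lemma nu_d_coaisle:
  assumes serre: "serre_functor T \<nu>" and qi: "quasi_inverse T \<nu> \<nu>i"
    and t: "t_structure T (T_le0 T M) (T_ge0 T M)" and M: "silt_ge T M (nu_d_inv T \<nu>i d M)"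
    and B: "\<And>i. i < c \<Longrightarrow> Hom T M (shift T i B) = {0}" and "i < c"
  shows "Hom T M (shift T i (on_obj \<nu> (shift T (- d) B))) = {0}"
proof -
  have "nu_d_inv T \<nu>i d M \<in> T_le0 T M"
    using M unfolding silt_ge_def T_le0_def by blast
  moreover have "shift T (i + 1) B \<in> T_ge0 T M"
    using B \<open>i < c\<close> unfolding T_ge0_def by simp
  ultimately have "Hom T (nu_d_inv T \<nu>i d M) (shift T i B) = {0}"
    using t_structure_Hom[OF t] by fastforce
  then have "Hom T M (on_obj \<nu> (shift T (- d) (shift T i B))) = {0}"
    unfolding nu_d_inv_Hom_eq_0_iff[OF qi] .
  then show ?thesis
    unfolding serre_Hom_shift_eq_0_iff[OF serre] by (simp add: add.commute)
qed

lemma nu_d_T_ge0: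
  assumes "serre_functor T \<nu>" "quasi_inverse T \<nu> \<nu>i"
    "t_structure T (T_le0 T M) (T_ge0 T M)" "silt_ge T M (nu_d_inv T \<nu>i d M)" "B \<in> T_ge0 T M"
  shows "on_obj \<nu> (shift T (- d) B) \<in> T_ge0 T M"
  using nu_d_coaisle[OF assms(1-4), of 0 B] assms(5) unfolding T_ge0_def by blast

lemma nu_d_inv_T_le0:
  assumes serre: "serre_functor T \<nu>" and qi: "quasi_inverse T \<nu> \<nu>i"
    and t: "t_structure T (T_le0 T M) (T_ge0 T M)" and M: "silt_ge T M (nu_d_inv T \<nu>i d M)"
    and X: "X \<in> T_le0 T M"
  shows "nu_d_inv T \<nu>i d X \<in> T_le0 T M"
proof (rule T_le0_if_orthogonal[OF t])
  fix B assume B: "B \<in> T_ge0 T M"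
  \<comment> \<open>?Y is nu_d (B[-1]), the target after adjunction. Threshold 1 puts ?Y[1] into the
    coaisle, so X has no nonzero map to ?Y.\<close>
  let ?Y = "on_obj \<nu> (shift T (- d) (shift T (-1) B))"
  have "Hom T M (shift T i (shift T (-1) B)) = {0}" if "i < 1" for i
    using B that unfolding T_ge0_def by simp
  then have "Hom T M (shift T i ?Y) = {0}" if "i < 1" for i
    using nu_d_coaisle[OF serre qi t M _ that] by blast
  then have "shift T 1 ?Y \<in> T_ge0 T M"
    unfolding T_ge0_def by simp
  then have "Hom T X (shift T (-1) (shift T 1 ?Y)) = {0}"
    using t_structure_Hom[OF t X] by blast
  then show "Hom T (nu_d_inv T \<nu>i d X) (shift T (-1) B) = {0}"
    unfolding nu_d_inv_Hom_eq_0_iff[OF qi] by simp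
qed

text \<open>Applying \<nu>^{-1} and then [d] replaces the test class by the objects that nu_d sends
  into the coaisle. These include the whole coaisle by \<open>nu_d_T_ge0\<close>.\<close>

lemma epi_wrt_nu_d_inv:
  assumes serre: "serre_functor T \<nu>" and qi: "quasi_inverse T \<nu> \<nu>i"
    and t: "t_structure T (T_le0 T M) (T_ge0 T M)" and M: "silt_ge T M (nu_d_inv T \<nu>i d M)"
    and f: "epi_wrt T (T_ge0 T M) X Y f"
  shows "\<exists>f'. epi_wrt T (T_ge0 T M) (nu_d_inv T \<nu>i d X) (nu_d_inv T \<nu>i d Y) f'"
  using epi_wrt_shift[OF epi_wrt_functor[OF qi f], of d] nu_d_T_ge0[OF serre qi t M]
  unfolding epi_wrt_def nu_d_inv_def by blast

section \<open>Cycles of simple objects\<close>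

lemma serre_Hom_nu_d_inv_eq_0_iff:
  assumes "serre_functor T \<nu>" "quasi_inverse T \<nu> \<nu>i"
  shows "Hom T (nu_d_inv T \<nu>i d X) Y = {0} \<longleftrightarrow> Hom T Y (shift T d X) = {0}"
  \<comment> \<open>Both sides are compared with Hom(X, nu_d Y): the left by adjunction, the right
    by Serre duality for Hom(Y[-d], X).\<close>
  by (simp add: nu_d_inv_Hom_eq_0_iff[OF assms(2)] serre_Hom_eq_0_iff[OF assms(1)]
      Hom_shift_left_eq_0_iff)

text \<open>A cycle is encoded as a set of simples in which every member has a predecessor;
  following predecessors gives chains of any length without index arithmetic modulo n.\<close>

theorem no_cyclic_extensions_of_simples:
  assumes serre: "serre_functor T \<nu>" and qi: "quasi_inverse T \<nu> \<nu>i"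
    and t: "t_structure T (T_le0 T M) (T_ge0 T M)" and M: "silt_ge T M (nu_d_inv T \<nu>i d M)"
    and fin: "nu_d_finite T \<nu>i d"
    and simple: "\<And>S. S \<in> \<S> \<Longrightarrow> simple_in T (heart T M) S"
    and pred: "\<And>S. S \<in> \<S> \<Longrightarrow> \<exists>S' \<in> \<S>. Hom T S' (shift T d S) \<noteq> {0}"
  shows "\<S> = {}"
proof (rule ccontr)
  assume "\<S> \<noteq> {}"
  then obtain S where S: "S \<in> \<S>" by blast
  let ?F = "nu_d_inv T \<nu>i d" and ?V = "T_ge0 T M"
  have step: "\<exists>S' \<in> \<S>. \<exists>f. epi_wrt T ?V (?F S) S' f" if S: "S \<in> \<S>" for S
  proof -
    obtain S' where S': "S' \<in> \<S>" "Hom T S' (shift T d S) \<noteq> {0}"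
      using pred[OF S] by blast
    then have "Hom T (?F S) S' \<noteq> {0}"
      using serre_Hom_nu_d_inv_eq_0_iff[OF serre qi] by blast
    then obtain f where "f \<in> Hom T (?F S) S'" "f \<noteq> 0"
      using zero_in_Hom by blast
    moreover have "?F S \<in> T_le0 T M"
      using nu_d_inv_T_le0[OF serre qi t M] simple[OF S] unfolding simple_in_def heart_def by blast
    ultimately show ?thesis
      using epi_wrt_simple[OF t simple[OF S'(1)]] S'(1) by blast
  qed
  have epi: "\<exists>S' \<in> \<S>. \<exists>f. epi_wrt T ?V ((?F ^^ k) S) S' f" for k
  proof (induction k)
    case 0
    show ?case using S epi_wrt_Ident by auto
  next
    case (Suc k)
    then obtain S' f where S': "S' \<in> \<S>" "epi_wrt T ?V ((?F ^^ k) S) S' f"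
      by blast
    \<comment> \<open>F f ends at F S', and \<open>step\<close> continues from there to another
      member of the set.\<close>
    then obtain f' where "epi_wrt T ?V ((?F ^^ Suc k) S) (?F S') f'"
      using epi_wrt_nu_d_inv[OF serre qi t M S'(2)] by auto
    then show ?case
      using step[OF S'(1)] epi_wrt_Comp by blast
  qed
  obtain N where N: "\<And>j. 0 \<le> j \<Longrightarrow> Hom T M (shift T j ((?F ^^ N) S)) = {0}"
    using fin unfolding nu_d_finite_def by blast
  obtain S' f where S': "S' \<in> \<S>" and f: "epi_wrt T ?V ((?F ^^ N) S) S' f"
    using epi by blast
  have S'V: "S' \<in> ?V" "\<not> zero_object T S'"
    using simple[OF S'] unfolding simple_in_def heart_def by auto
  \<comment> \<open>The degree j = 0 in the finiteness condition is what allows the extra shift by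
    -1.\<close>
  have "shift T (-1) ((?F ^^ N) S) \<in> T_le0 T M"
    using N unfolding T_le0_def by simp
  then have "Hom T ((?F ^^ N) S) S' = {0}"
    using t_structure_Hom[OF t _ S'V(1)] Hom_shift_eq_0_iff[of "-1"] by blast
  then have "f = 0"
    using f unfolding epi_wrt_def by blast
  \<comment> \<open>S' itself lies in the coaisle, so its identity is an admissible test morphism
    for f.\<close>
  then have "Ident T S' \<cdot> f = 0"
    using Comp_zero_right[OF Id_in] by simp
  then have "Ident T S' = 0"
    using f S'V(1) Id_in unfolding epi_wrt_def by blast
  then show False
    using S'V(2) zero_object_iff by blast
qed

end

theorem theorem5p2:
  fixes T :: "('k::field, 'o, 'm::ab_group_add) tri_cat"
    and M :: 'o and d :: int
    and \<nu> \<nu>i :: "('o, 'm) endofunctor"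
  assumes "triangulated_category T"
    and "M \<in> silt T"
    and T0: "hom_finite T" "krull_schmidt T"
    and T1: "serre_functor T \<nu>" "quasi_inverse T \<nu> \<nu>i"
    and T2: "t_structure T (T_le0 T M) (T_ge0 T M)"
    and T3: "silt_ge T M (nu_d_inv T \<nu>i d M)"
    and "nu_d_finite T \<nu>i d"
  shows "(\<nexists>(n::nat) (S :: nat \<Rightarrow> 'o). n \<ge> 1 \<and>
            (\<forall>i \<in> {1..n + 1}. simple_in T (heart T M) (S i)) \<and> S (n + 1) = S 1 \<and>
            (\<forall>i \<in> {1..n}. Hom T (S i) (shift T d (S (i + 1))) \<noteq> {0})) \<and>
         (\<nexists>S. simple_in T (heart T M) S \<and> Hom T S (shift T d S) \<noteq> {0})"
proof -
  interpret triangulated_category T by fact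
  note no_cycle = no_cyclic_extensions_of_simples[OF T1 T2 T3 \<open>nu_d_finite T \<nu>i d\<close>]
  have "False" if n: "n \<ge> 1" and simple: "\<forall>i \<in> {1..n + 1}. simple_in T (heart T M) (S i)"
    and cyc: "S (n + 1) = S 1" and Hom: "\<forall>i \<in> {1..n}. Hom T (S i) (shift T d (S (i + 1))) \<noteq> {0}"
    for n :: nat and S :: "nat \<Rightarrow> 'o"
  proof -
    have "\<exists>j \<in> {1..n}. Hom T (S j) (shift T d (S i)) \<noteq> {0}" if "i \<in> {1..n}" for i
    proof (cases "i = 1")
      \<comment> \<open>The predecessor of S 1 is S n, because S (n + 1) = S 1.\<close>
      case True
      then show ?thesis using Hom[rule_format, of n] cyc n by (intro bexI[of _ n]) auto
    next
      case False
      with that have "i - 1 \<in> {1..n}" "i - 1 + 1 = i" by auto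
      then show ?thesis using Hom by metis
    qed
    then have "S ` {1..n} = {}"
      using simple by (intro no_cycle) auto
    then show False using n by simp
  qed
  \<comment> \<open>A self-extension makes S its own predecessor in the singleton set.\<close>
  moreover have "False" if "simple_in T (heart T M) S" "Hom T S (shift T d S) \<noteq> {0}" for S
    using no_cycle[of "{S}"] that by blast
  ultimately show ?thesis by blast
qed

end
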